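(* Let $q_9\in(1,2)$ be the $9$-Bonacci number ($q_9=1.99803\ldots$). If $q \in (q_9,2)$ then there is some $y \in [0,1]$ such that $|\mathrm{sl}_q(y)| = 3$.
   Context: For an integer $k\ge 2$, the $k$-Bonacci number $q_k$ is the real number $q\in(1,2)$ satisfying $q^k - q^{k-1} - \cdots - q - 1 = 0$. For $q\in(1,2)$ define maps on $[0,1]^2$ (the Okamoto IFS) by $S_0(x,y) = \left(\frac{x}{3}, \frac{y}{q}\right)$, $S_1(x,y) = \left(\frac{x+1}{3}, \left(\frac{2}{q}-1\right)(1-y) + \left(1-\frac{1}{q}\right)\right)$, $S_2(x,y) = \left(\frac{x+2}{3}, \frac{y}{q} + \left(1-\frac{1}{q}\right)\right)$. $K_q$ is the unique nonempty compact subset of $[0,1]^2$ with $K_q = S_0(K_q)\cup S_1(K_q)\cup S_2(K_q)$. For $y\in[0,1]$ the horizontal slice at $y$ is $\mathrm{sl}_q(y) = \{x\in[0,1] : (x,y)\in K_q\}$. $|\cdot|$ denotes cardinality. *)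

theory Defs
  imports "HOL-Analysis.Analysis"
begin

definition kbonacci :: "nat \<Rightarrow> real" where
  "kbonacci k = (THE q. 1 < q \<and> q < 2 \<and> q ^ k - (\<Sum>i<k. q ^ i) = 0)"

definition okamoto_S0 :: "real \<Rightarrow> real \<times> real \<Rightarrow> real \<times> real" where
  "okamoto_S0 q = (\<lambda>(x, y). (x / 3, y / q))"

definition okamoto_S1 :: "real \<Rightarrow> real \<times> real \<Rightarrow> real \<times> real" where
  "okamoto_S1 q = (\<lambda>(x, y). ((x + 1) / 3, (2 / q - 1) * (1 - y) + (1 - 1 / q)))"

definition okamoto_S2 :: "real \<Rightarrow> real \<times> real \<Rightarrow> real \<times> real" where
  "okamoto_S2 q = (\<lambda>(x, y). ((x + 2) / 3, y / q + (1 - 1 / q)))"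

(* For 1 < q < 2 the three maps are contractions of the unit square into itself,
   so exactly one set satisfies the description (Hutchinson). *)
definition okamoto_set :: "real \<Rightarrow> (real \<times> real) set" where
  "okamoto_set q = (THE K. K \<noteq> {} \<and> compact K \<and> K \<subseteq> {0..1} \<times> {0..1} \<and>
     K = okamoto_S0 q ` K \<union> okamoto_S1 q ` K \<union> okamoto_S2 q ` K)"

definition slice :: "real \<Rightarrow> real \<Rightarrow> real set" where
  "slice q y = {x \<in> {0..1}. (x, y) \<in> okamoto_set q}"

end

theory Submission
  imports Defs
begin

text \<open>
  Write \<open>\<delta> = 2 - q\<close>. The images of the unit interval under the three vertical maps cover
  \<open>[0, 1]\<close>; they meet exactly in the short overlap \<open>[1 - 1/q, 1/q]\<close>, of length \<open>\<delta>/q\<close>, and a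
  height outside it has one preimage only. Hence a height has a one-point slice as soon as
  its orbit under the expanding map that inverts the two increasing branches never enters the
  overlap (\<open>slice_singleton\<close>).

  A height inside the overlap has three preimages, and if \<open>z\<close> denotes the one under the
  decreasing branch, then the other two are \<open>1 - \<delta> z\<close> and \<open>\<delta> (1 - z)\<close>. So it suffices to find
  \<open>z\<close> in \<open>(0, 1)\<close> such that the orbits of all three of \<open>z\<close>, \<open>1 - \<delta> z\<close> and \<open>\<delta> (1 - z)\<close> avoid
  the overlap (\<open>simultaneous_avoidance\<close>): the slice is then the union of three one-point
  sets, which lie in different thirds of \<open>[0, 1]\<close>.

  Each of the three requirements excludes a union of small gaps from the line, organised by
  the time \<open>m\<close> at which the orbit hits the overlap for the first time. The decisive fact
  (\<open>first_hit_separated\<close>) is that points with the same first hitting time \<open>m\<close> are either at most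
  \<open>\<delta> q^-(m+1)\<close> or at least \<open>(1 - 1/q) q^-m\<close> apart; the second length is at least \<open>499\<close> times
  the first when \<open>q > 1.998\<close>. An interval shorter than the second length therefore meets a single
  tiny cluster of each family at this level. A nested sequence of intervals, each about
  \<open>32\<close> times shorter than its predecessor and
  clear of five further levels of the three families, can then be continued forever: the
  \<open>15\<close> clusters cannot block all positions of the next interval
  (\<open>escape_sparse_families\<close>). The lower bound on \<open>q\<close> enters in the form
  \<open>q > 1.998\<close> (\<open>kbonacci_9_gt\<close>).
\<close>

section \<open>The attractor and its slices\<close>

definition okamoto_invariant :: "real \<Rightarrow> (real \<times> real) set \<Rightarrow> bool" where
  "okamoto_invariant q K \<longleftrightarrow> K \<noteq> {} \<and> compact K \<and> K \<subseteq> {0..1} \<times> {0..1} \<and>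
     K = okamoto_S0 q ` K \<union> okamoto_S1 q ` K \<union> okamoto_S2 q ` K"

lemma dist_Pair_le_scaled:
  fixes x y x' y' :: real
  assumes "0 \<le> c" "\<bar>u - u'\<bar> \<le> c * \<bar>x - x'\<bar>" "\<bar>v - v'\<bar> \<le> c * \<bar>y - y'\<bar>"
  shows "dist (u, v) (u', v') \<le> c * dist (x, y) (x', y')"
proof -
  have a: "(u - u')\<^sup>2 \<le> c\<^sup>2 * (x - x')\<^sup>2"
    using power_mono[OF assms(2), of 2] by (simp add: power_mult_distrib)
  have b: "(v - v')\<^sup>2 \<le> c\<^sup>2 * (y - y')\<^sup>2"
    using power_mono[OF assms(3), of 2] by (simp add: power_mult_distrib)
  have "sqrt ((u - u')\<^sup>2 + (v - v')\<^sup>2) \<le> sqrt (c\<^sup>2 * ((x - x')\<^sup>2 + (y - y')\<^sup>2))"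
    using a b by (simp add: distrib_left)
  also have "\<dots> = c * sqrt ((x - x')\<^sup>2 + (y - y')\<^sup>2)"
    using assms(1) by (simp add: real_sqrt_mult)
  finally show ?thesis by (simp add: dist_Pair_Pair dist_real_def)
qed

lemma okamoto_maps_contract:
  assumes "1 < q" "q < 2" and S: "S \<in> {okamoto_S0 q, okamoto_S1 q, okamoto_S2 q}"
  shows "dist (S p) (S p') \<le> (1 / q) * dist p p'"
proof -
  obtain x y x' y' where p: "p = (x, y)" "p' = (x', y')" by fastforce
  have x: "\<bar>x - x'\<bar> / 3 \<le> (1 / q) * \<bar>x - x'\<bar>"
    using assms(1,2) mult_right_mono[of "1/3" "1/q" "\<bar>x - x'\<bar>"] by (simp add: field_simps)
  have y1: "(2 / q - 1) * \<bar>y - y'\<bar> \<le> (1 / q) * \<bar>y - y'\<bar>"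
    using assms(1,2) by (intro mult_right_mono) (auto simp: field_simps)
  have eq: "(2 / q - 1) * (1 - y) + (1 - 1 / q) - ((2 / q - 1) * (1 - y') + (1 - 1 / q))
      = (2 / q - 1) * (y' - y)" by (simp only: algebra_simps)
  have y2: "\<bar>(2 / q - 1) * (1 - y) + (1 - 1 / q) - ((2 / q - 1) * (1 - y') + (1 - 1 / q))\<bar>
      \<le> (1 / q) * \<bar>y - y'\<bar>"
    unfolding eq abs_mult using y1 assms(1,2)
    by (simp add: abs_minus_commute field_simps)
  have y0: "\<bar>y / q - y' / q\<bar> \<le> (1 / q) * \<bar>y - y'\<bar>"
    using assms(1) by (simp flip: diff_divide_distrib)
  have third: "\<bar>(x + e) / 3 - (x' + e) / 3\<bar> \<le> (1 / q) * \<bar>x - x'\<bar>" for e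
    using x by (simp flip: diff_divide_distrib)
  from S consider "S = okamoto_S0 q" | "S = okamoto_S1 q" | "S = okamoto_S2 q" by auto
  then show ?thesis
  proof cases
    case 1
    then show ?thesis using third[of 0] y0 assms(1) unfolding p okamoto_S0_def prod.case 1
      by (intro dist_Pair_le_scaled) auto
  next
    case 2
    then show ?thesis using third[of 1] y2 assms(1) unfolding p okamoto_S1_def prod.case 2
      by (intro dist_Pair_le_scaled) auto
  next
    case 3
    then show ?thesis using third[of 2] y0 assms(1) unfolding p okamoto_S2_def prod.case 3
      by (intro dist_Pair_le_scaled) auto
  qed
qed

lemma okamoto_maps_inj:
  assumes "1 < q" "q < 2"
  shows "inj (okamoto_S0 q)" "inj (okamoto_S1 q)" "inj (okamoto_S2 q)"
  using assms by (auto intro!: injI simp: okamoto_S0_def okamoto_S1_def okamoto_S2_def)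

lemma okamoto_maps_square:
  assumes "1 < q" "q < 2" "S \<in> {okamoto_S0 q, okamoto_S1 q, okamoto_S2 q}"
  shows "S ` ({0..1} \<times> {0..1}) \<subseteq> {0..1} \<times> {0..1}"
proof -
  have "0 \<le> (2 / q - 1) * (1 - y) + (1 - 1 / q) \<and> (2 / q - 1) * (1 - y) + (1 - 1 / q) \<le> 1"
    if "0 \<le> y" "y \<le> 1" for y
  proof -
    have pos: "0 \<le> 2 / q - 1" using assms(1,2) by simp
    define P where "P = (2 / q - 1) * (1 - y)"
    have "0 \<le> P" unfolding P_def using pos that by (intro mult_nonneg_nonneg) auto
    moreover have "P \<le> 2 / q - 1"
      unfolding P_def using mult_left_mono[OF _ pos, of "1 - y" 1] that by simp
    moreover have "2 / q = 1 / q + 1 / q" "1 / q \<le> 1" using assms(1,2) by (simp_all add: field_simps)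
    ultimately show ?thesis unfolding P_def[symmetric] by (intro conjI; linarith)
  qed
  moreover have "0 \<le> y / q + (1 - 1 / q) \<and> y / q + (1 - 1 / q) \<le> 1 \<and> 0 \<le> y / q \<and> y / q \<le> 1"
    if "0 \<le> y" "y \<le> 1" for y
  proof -
    have "0 \<le> y / q" "y / q \<le> 1 / q" "1 / q \<le> 1"
      using assms(1) that by (auto intro: divide_right_mono)
    then show ?thesis by auto
  qed
  ultimately show ?thesis
    using assms(3) by (auto simp: okamoto_S0_def okamoto_S1_def okamoto_S2_def)
qed

text \<open>The distance to \<open>L\<close> attains its maximum over \<open>K\<close>, and the contraction by \<open>1/q\<close> bounds this
  maximum by \<open>1/q\<close> times itself. Exchanging the roles of \<open>K\<close> and \<open>L\<close> gives uniqueness of the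
  attractor.\<close>
lemma okamoto_invariant_subset:
  assumes q: "1 < q" "q < 2" and K: "okamoto_invariant q K" and L: "okamoto_invariant q L"
  shows "K \<subseteq> L"
proof -
  have "continuous_on K (\<lambda>p. infdist p L)"
    by (intro continuous_on_infdist continuous_on_id)
  then obtain p where p: "p \<in> K" and max: "\<And>p'. p' \<in> K \<Longrightarrow> infdist p' L \<le> infdist p L"
    using continuous_attains_sup[of K "\<lambda>p. infdist p L"] K
    unfolding okamoto_invariant_def by blast
  have L': "compact L" "L \<noteq> {}" using L by (auto simp: okamoto_invariant_def)
  from p K have "p \<in> okamoto_S0 q ` K \<union> okamoto_S1 q ` K \<union> okamoto_S2 q ` K"
    unfolding okamoto_invariant_def by blast
  then obtain S p' where S: "S \<in> {okamoto_S0 q, okamoto_S1 q, okamoto_S2 q}"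
    and p': "p' \<in> K" "p = S p'" by blast
  obtain l where l: "l \<in> L" "infdist p' L = dist p' l"
    using infdist_attains_inf[of L p'] L' compact_imp_closed by auto
  have "okamoto_S0 q ` L \<union> okamoto_S1 q ` L \<union> okamoto_S2 q ` L = L"
    using L unfolding okamoto_invariant_def by metis
  then have "S l \<in> L" using S l(1) by blast
  then have "infdist p L \<le> dist (S p') (S l)" unfolding p'(2) by (rule infdist_le)
  also have "\<dots> \<le> (1 / q) * infdist p' L"
    using okamoto_maps_contract[OF q S] l(2) by simp
  also have "\<dots> \<le> (1 / q) * infdist p L" using max[OF p'(1)] q by (intro mult_left_mono) auto
  finally have "infdist p L * (q - 1) \<le> 0" using q by (simp add: field_simps)
  then have "infdist p L \<le> 0" using q by (simp add: mult_le_0_iff)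
  then have "infdist p'' L = 0" if "p'' \<in> K" for p''
    using max[OF that] infdist_nonneg[of p'' L] by linarith
  then show ?thesis
    using in_closed_iff_infdist_zero[of L] L' compact_imp_closed by blast
qed

text \<open>The attractor is the intersection of the decreasing iterated images of the unit square;
  injectivity of the maps lets the intersection commute with taking images.\<close>
lemma okamoto_invariant_exists:
  assumes q: "1 < q" "q < 2"
  shows "\<exists>K. okamoto_invariant q K"
proof -
  define \<Phi> where "\<Phi> K = okamoto_S0 q ` K \<union> okamoto_S1 q ` K \<union> okamoto_S2 q ` K" for K
  define Q :: "nat \<Rightarrow> (real \<times> real) set" where "Q n = (\<Phi> ^^ n) ({0..1} \<times> {0..1})" for n
  have Q0: "Q 0 = {0..1} \<times> {0..1}" and QS: "Q (Suc n) = \<Phi> (Q n)" for n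
    by (simp_all add: Q_def)
  have mono: "\<Phi> A \<subseteq> \<Phi> B" if "A \<subseteq> B" for A B using that unfolding \<Phi>_def by blast
  have "Q (Suc n) \<subseteq> Q n" for n
  proof (induction n)
    case 0
    then show ?case using okamoto_maps_square[OF q] unfolding QS Q0 \<Phi>_def by simp
  next
    case (Suc n)
    then show ?case using mono QS by metis
  qed
  then have dec: "Q n \<subseteq> Q m" if "m \<le> n" for m n
    using lift_Suc_antimono_le[of Q] that by blast
  have cont: "continuous_on A S" if "S \<in> {okamoto_S0 q, okamoto_S1 q, okamoto_S2 q}" for S A
    using that unfolding okamoto_S0_def okamoto_S1_def okamoto_S2_def case_prod_unfold
    by (auto intro!: continuous_intros) (use q in auto)
  have cpt: "compact (Q n)" for n
  proof (induction n)
    case 0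
    then show ?case unfolding Q0 by (intro compact_Times compact_Icc)
  next
    case (Suc n)
    then show ?case unfolding QS \<Phi>_def
      by (intro compact_Un compact_continuous_image cont) auto
  qed
  have ne: "Q n \<noteq> {}" for n
    by (induction n) (auto simp: Q0 QS \<Phi>_def)
  define K where "K = (\<Inter>n. Q n)"
  have "K \<noteq> {}"
    unfolding K_def using compact_nest[of Q] cpt ne dec by blast
  moreover have "compact K"
    unfolding K_def using cpt by (intro compact_Inter) auto
  moreover have "K \<subseteq> {0..1} \<times> {0..1}" unfolding K_def using Q0 by blast
  moreover have "\<Phi> K \<subseteq> K"
  proof -
    have "\<Phi> K \<subseteq> Q n" for n
    proof -
      have "\<Phi> K \<subseteq> Q (Suc n)" unfolding QS by (rule mono) (auto simp: K_def)
      then show ?thesis using dec[of n "Suc n"] by auto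
    qed
    then show ?thesis unfolding K_def by blast
  qed
  moreover have "K \<subseteq> \<Phi> K"
  proof
    fix p assume "p \<in> K"
    then have "p \<in> \<Phi> (Q n)" for n using QS unfolding K_def by blast
    \<comment> \<open>One of the three maps serves infinitely many stages, hence by monotonicity all of them.\<close>
    then have "\<exists>S\<in>{okamoto_S0 q, okamoto_S1 q, okamoto_S2 q}. p \<in> S ` Q n" for n
      unfolding \<Phi>_def by blast
    then have "\<exists>S\<in>{okamoto_S0 q, okamoto_S1 q, okamoto_S2 q}. \<forall>n. p \<in> S ` Q n"
    proof -
      assume a: "\<And>n. \<exists>S\<in>{okamoto_S0 q, okamoto_S1 q, okamoto_S2 q}. p \<in> S ` Q n"
      show ?thesis
      proof (rule ccontr)
        assume "\<not> ?thesis"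
        then obtain k0 k1 k2 where k: "p \<notin> okamoto_S0 q ` Q k0" "p \<notin> okamoto_S1 q ` Q k1"
          "p \<notin> okamoto_S2 q ` Q k2" by auto
        have "Q (k0 + k1 + k2) \<subseteq> Q k0" "Q (k0 + k1 + k2) \<subseteq> Q k1" "Q (k0 + k1 + k2) \<subseteq> Q k2"
          by (auto intro!: dec)
        then show False using a[of "k0 + k1 + k2"] k by blast
      qed
    qed
    then obtain S where S: "S \<in> {okamoto_S0 q, okamoto_S1 q, okamoto_S2 q}"
      and pS: "\<And>n. p \<in> S ` Q n" by blast
    have "inj S" using S okamoto_maps_inj[OF q] by auto
    then obtain p' where "p = S p'" "\<And>n. p' \<in> Q n" using pS by (metis imageE injD)
    then show "p \<in> \<Phi> K" using S unfolding \<Phi>_def K_def by blast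
  qed
  ultimately show ?thesis unfolding okamoto_invariant_def \<Phi>_def by blast
qed

lemma okamoto_set_invariant:
  assumes "1 < q" "q < 2"
  shows "okamoto_invariant q (okamoto_set q)"
proof -
  obtain K where "okamoto_invariant q K" using okamoto_invariant_exists[OF assms] by blast
  moreover have "L = K" if "okamoto_invariant q L" for L
    using okamoto_invariant_subset[OF assms that \<open>okamoto_invariant q K\<close>]
      okamoto_invariant_subset[OF assms \<open>okamoto_invariant q K\<close> that] by (rule subset_antisym)
  ultimately have "okamoto_invariant q (THE K. okamoto_invariant q K)" by (rule theI)
  then show ?thesis unfolding okamoto_set_def okamoto_invariant_def .
qed

text \<open>The self-similarity of the attractor, read backwards through the inverses of the three maps.
  Preimages that leave the unit square simply fail to belong to the set.\<close>
lemma mem_okamoto_set_iff: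
  assumes "1 < q" "q < 2"
  shows "(x, y) \<in> okamoto_set q \<longleftrightarrow>
    (3 * x, q * y) \<in> okamoto_set q \<or>
    (3 * x - 1, (1 - q * y) / (2 - q)) \<in> okamoto_set q \<or>
    (3 * x - 2, q * y - (q - 1)) \<in> okamoto_set q"
proof -
  let ?K = "okamoto_set q"
  have K: "?K = okamoto_S0 q ` ?K \<union> okamoto_S1 q ` ?K \<union> okamoto_S2 q ` ?K"
    using okamoto_set_invariant[OF assms] unfolding okamoto_invariant_def by blast
  have "(x, y) = okamoto_S0 q (x', y') \<longleftrightarrow> x' = 3 * x \<and> y' = q * y" for x' y'
    using assms by (auto simp: okamoto_S0_def field_simps)
  moreover have "(x, y) = okamoto_S1 q (x', y') \<longleftrightarrow> x' = 3 * x - 1 \<and> y' = (1 - q * y) / (2 - q)"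
    for x' y'
  proof -
    have "(2 / q - 1) * (1 - y') + (1 - 1 / q) = (1 - (2 - q) * y') / q"
      using assms by (simp add: field_simps)
    then have "(x, y) = okamoto_S1 q (x', y') \<longleftrightarrow> x = (x' + 1) / 3 \<and> y = (1 - (2 - q) * y') / q"
      by (simp add: okamoto_S1_def)
    then show ?thesis using assms by (auto simp: field_simps)
  qed
  moreover have "(x, y) = okamoto_S2 q (x', y') \<longleftrightarrow> x' = 3 * x - 2 \<and> y' = q * y - (q - 1)"
    for x' y'
    using assms by (auto simp: okamoto_S2_def field_simps)
  moreover have "(x, y) \<in> S ` ?K \<longleftrightarrow> (\<exists>x' y'. (x, y) = S (x', y') \<and> (x', y') \<in> ?K)" for S
    by (force simp: image_iff)
  ultimately have "(x, y) \<in> okamoto_S0 q ` ?K \<union> okamoto_S1 q ` ?K \<union> okamoto_S2 q ` ?K \<longleftrightarrow>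
    (3 * x, q * y) \<in> ?K \<or> (3 * x - 1, (1 - q * y) / (2 - q)) \<in> ?K \<or>
    (3 * x - 2, q * y - (q - 1)) \<in> ?K"
    by simp
  then show ?thesis using K by blast
qed

lemma okamoto_set_in_square:
  assumes "1 < q" "q < 2" "(x, y) \<in> okamoto_set q"
  shows "0 \<le> x" "x \<le> 1" "0 \<le> y" "y \<le> 1"
  using okamoto_set_invariant[OF assms(1,2)] assms(3) unfolding okamoto_invariant_def by auto

lemma nonpos_if_bounded_powers:
  fixes e q :: real
  assumes "1 < q" "\<And>n. q ^ n * e \<le> 1"
  shows "e \<le> 0"
proof (rule ccontr)
  assume "\<not> e \<le> 0"
  then obtain n where "1 / e < q ^ n" using real_arch_pow[OF assms(1)] by blast
  then show False using assms(2)[of n] \<open>\<not> e \<le> 0\<close> by (simp add: field_simps)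
qed

text \<open>A point on the left edge can only come from the first map, so \<open>y\<close> could be multiplied by \<open>q\<close>
  forever without leaving \<open>[0, 1]\<close>. This and the statement for the right edge keep the point of the
  slice at \<open>z\<close> away from the ends, where two of the thirds would share a point.\<close>
lemma okamoto_set_left_edge:
  assumes q: "1 < q" "q < 2" and "(0, y) \<in> okamoto_set q"
  shows "y = 0"
proof -
  have "(0, q ^ n * y) \<in> okamoto_set q" for n
  proof (induction n)
    case (Suc n)
    then show ?case
      using mem_okamoto_set_iff[OF q, of 0 "q ^ n * y"] okamoto_set_in_square(1)[OF q]
      by (fastforce simp: mult.assoc)
  qed (use assms in simp)
  then have "q ^ n * y \<le> 1" for n using okamoto_set_in_square[OF q] by blast
  then have "y \<le> 0" using nonpos_if_bounded_powers[OF q(1)] by blast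
  then show ?thesis using okamoto_set_in_square[OF q assms(3)] by linarith
qed

lemma okamoto_set_right_edge:
  assumes q: "1 < q" "q < 2" and "(1, y) \<in> okamoto_set q"
  shows "y = 1"
proof -
  have "(1, 1 - q ^ n * (1 - y)) \<in> okamoto_set q" for n
  proof (induction n)
    case (Suc n)
    have eq: "q * (1 - q ^ n * (1 - y)) - (q - 1) = 1 - q ^ Suc n * (1 - y)"
      by (simp add: algebra_simps)
    have "(s, t) \<notin> okamoto_set q" if "s > 1" for s t
      using okamoto_set_in_square(2)[OF q, of s t] that by linarith
    then have "(1, q * (1 - q ^ n * (1 - y)) - (q - 1)) \<in> okamoto_set q"
      using mem_okamoto_set_iff[OF q, of 1 "1 - q ^ n * (1 - y)"] Suc by simp
    then show ?case by (simp only: eq)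
  qed (use assms in simp)
  then have "q ^ n * (1 - y) \<le> 1" for n using okamoto_set_in_square[OF q] by fastforce
  then have "1 - y \<le> 0" using nonpos_if_bounded_powers[OF q(1)] by blast
  then show ?thesis using okamoto_set_in_square[OF q assms(3)] by linarith
qed

section \<open>Orbits that avoid the overlap\<close>

definition overlap :: "real \<Rightarrow> real set" where
  "overlap q = {1 - 1 / q..1 / q}"

text \<open>The inverse of the lower increasing branch up to \<open>1/2\<close> and of the upper one beyond. The cut
  \<open>1/2\<close> is the midpoint of the overlap; off the overlap, the branch chosen is the only possible one.\<close>
definition unfold_map :: "real \<Rightarrow> real \<Rightarrow> real" where
  "unfold_map q y = (if y \<le> 1 / 2 then q * y else q * y - (q - 1))"

lemma unfold_map_unit:
  assumes "1 < q" "q < 2" "y \<in> {0..1}"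
  shows "unfold_map q y \<in> {0..1}"
proof -
  have le: "q * y \<le> q * 1" "0 \<le> q * y" using assms by (auto intro!: mult_left_mono)
  show ?thesis
  proof (cases "y \<le> 1 / 2")
    case True
    then have "q * y \<le> q * (1 / 2)" using assms by (intro mult_left_mono) auto
    then have "q * y \<le> 1" using assms(2) by linarith
    then show ?thesis using le assms True by (simp add: unfold_map_def)
  next
    case False
    then have "q * (1 / 2) \<le> q * y" using assms by (intro mult_left_mono) auto
    then have "q - 1 \<le> q * y" using assms(2) by linarith
    then show ?thesis using le assms False by (simp add: unfold_map_def)
  qed
qed

lemma unfold_map_iter_unit:
  assumes "1 < q" "q < 2" "y \<in> {0..1}"
  shows "(unfold_map q ^^ n) y \<in> {0..1}"
  by (induction n) (use assms unfold_map_unit in auto)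

text \<open>Both increasing branches map the projection \<open>P\<close> of the attractor to the vertical axis into
  itself, so one step of the unfolding map multiplies the distance to \<open>P\<close> at least by \<open>q\<close>. As the
  orbit stays in \<open>[0, 1]\<close>, where this distance is at most \<open>1\<close>, the distance vanishes.\<close>
lemma slice_nonempty:
  assumes q: "1 < q" "q < 2" and y: "y \<in> {0..1}"
  shows "slice q y \<noteq> {}"
proof -
  define P where "P = snd ` okamoto_set q"
  have inv: "okamoto_invariant q (okamoto_set q)" by (rule okamoto_set_invariant[OF q])
  have "compact P" unfolding P_def using inv
    by (intro compact_continuous_image continuous_on_snd continuous_on_id)
      (auto simp: okamoto_invariant_def)
  have "P \<noteq> {}" and P01: "P \<subseteq> {0..1}"
    using inv unfolding P_def okamoto_invariant_def by auto
  have pull: "w \<in> P" if "q * w \<in> P \<or> q * w - (q - 1) \<in> P" for w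
  proof -
    from that have "\<exists>x. (x, q * w) \<in> okamoto_set q \<or> (x, q * w - (q - 1)) \<in> okamoto_set q"
      unfolding P_def by auto
    then obtain x where "(x, q * w) \<in> okamoto_set q \<or> (x, q * w - (q - 1)) \<in> okamoto_set q"
      by blast
    moreover have "3 * (x / 3) = x" "3 * ((x + 2) / 3) - 2 = x" by (simp_all add: field_simps)
    ultimately have "(x / 3, w) \<in> okamoto_set q \<or> ((x + 2) / 3, w) \<in> okamoto_set q"
      using mem_okamoto_set_iff[OF q, of "x / 3" w] mem_okamoto_set_iff[OF q, of "(x + 2) / 3" w]
      by metis
    then show ?thesis unfolding P_def by force
  qed
  have step: "q * infdist w P \<le> infdist (unfold_map q w) P" for w
  proof -
    obtain p where p: "p \<in> P" "infdist (unfold_map q w) P = \<bar>unfold_map q w - p\<bar>"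
      using infdist_attains_inf[of P "unfold_map q w"] \<open>compact P\<close> \<open>P \<noteq> {}\<close> compact_imp_closed
      by (metis dist_real_def)
    define s where "s = (if w \<le> 1 / 2 then 0 else q - 1)"
    have "q * ((p + s) / q) = p + s" using q by simp
    then have "(p + s) / q \<in> P" using p(1) by (intro pull) (auto simp: s_def)
    then have "q * infdist w P \<le> q * \<bar>w - (p + s) / q\<bar>"
      using q infdist_le[of "(p + s) / q" P w] by (intro mult_left_mono) (auto simp: dist_real_def)
    also have "\<dots> = \<bar>q * (w - (p + s) / q)\<bar>" using q by (simp add: abs_mult)
    also have "q * (w - (p + s) / q) = unfold_map q w - p"
      using q by (simp add: unfold_map_def s_def field_simps)
    finally show ?thesis using p(2) by simp
  qed
  have "q ^ n * infdist y P \<le> infdist ((unfold_map q ^^ n) y) P" for n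
  proof (induction n)
    case (Suc n)
    have "q ^ Suc n * infdist y P \<le> q * infdist ((unfold_map q ^^ n) y) P"
      using Suc q by (simp add: mult.assoc)
    also have "\<dots> \<le> infdist ((unfold_map q ^^ Suc n) y) P" using step by simp
    finally show ?case .
  qed simp
  moreover have "infdist w P \<le> 1" if "w \<in> {0..1}" for w
  proof -
    obtain p where "p \<in> P" using \<open>P \<noteq> {}\<close> by blast
    then have "infdist w P \<le> dist w p" by (rule infdist_le)
    moreover have "\<bar>w - p\<bar> \<le> 1" using that P01 \<open>p \<in> P\<close> by (auto simp: abs_le_iff)
    ultimately show ?thesis by (simp add: dist_real_def)
  qed
  ultimately have "infdist y P \<le> 0"
    using unfold_map_iter_unit[OF q y] order_trans nonpos_if_bounded_powers[OF q(1)] by metis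
  then have "y \<in> P"
    using in_closed_iff_infdist_zero[of P y] \<open>compact P\<close> \<open>P \<noteq> {}\<close> compact_imp_closed
      infdist_nonneg[of y P] by (metis antisym)
  then show ?thesis
    using okamoto_set_in_square[OF q] unfolding slice_def P_def by fastforce
qed

lemma mem_okamoto_set_off_overlap:
  assumes q: "1 < q" "q < 2" and y: "y \<notin> overlap q"
  shows "(x, y) \<in> okamoto_set q \<longleftrightarrow>
    (3 * x - (if y \<le> 1 / 2 then 0 else 2), unfold_map q y) \<in> okamoto_set q"
proof -
  have "1 / q > 1 / 2" using q by (simp add: field_simps)
  then have cases: "y \<le> 1 / 2 \<and> y < 1 - 1 / q \<or> \<not> y \<le> 1 / 2 \<and> y > 1 / q"
    using y unfolding overlap_def by auto
  have lo: "q * y - (q - 1) < 0 \<and> (1 - q * y) / (2 - q) > 1" if "y < 1 - 1 / q"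
    using that q by (auto simp: field_simps)
  have hi: "q * y > 1 \<and> (1 - q * y) / (2 - q) < 0" if "y > 1 / q"
    using that q by (auto simp: field_simps)
  show ?thesis
    using mem_okamoto_set_iff[OF q, of x y] okamoto_set_in_square[OF q] cases lo hi
    unfolding unfold_map_def by (smt (verit, best))
qed

text \<open>While the orbit stays off the overlap, every step determines one more ternary digit of \<open>x\<close>,
  so two points of the slice agree to every order.\<close>
lemma slice_singleton:
  assumes q: "1 < q" "q < 2" and y: "y \<in> {0..1}"
    and avoid: "\<And>n. (unfold_map q ^^ n) y \<notin> overlap q"
  obtains u where "\<And>x. (x, y) \<in> okamoto_set q \<longleftrightarrow> x = u" "0 \<le> u" "u \<le> 1"
proof -
  have shrink: "3 ^ n * \<bar>x - x'\<bar> \<le> 1"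
    if "\<And>n. (unfold_map q ^^ n) w \<notin> overlap q" "(x, w) \<in> okamoto_set q" "(x', w) \<in> okamoto_set q"
    for n x x' w
    using that
  proof (induction n arbitrary: x x' w)
    case 0
    then show ?case
      using okamoto_set_in_square[OF q 0(2)] okamoto_set_in_square[OF q 0(3)] by (simp add: abs_le_iff)
  next
    case (Suc n)
    define d :: real where "d = (if w \<le> 1 / 2 then 0 else 2)"
    have off: "w \<notin> overlap q" using Suc.prems(1)[of 0] by simp
    have "(unfold_map q ^^ k) (unfold_map q w) \<notin> overlap q" for k
      using Suc.prems(1)[of "Suc k"] by (simp add: funpow_swap1)
    then have "3 ^ n * \<bar>(3 * x - d) - (3 * x' - d)\<bar> \<le> 1"
      using mem_okamoto_set_off_overlap[OF q off] Suc.prems(2,3) unfolding d_def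
      by (intro Suc.IH) auto
    moreover have "\<bar>(3 * x - d) - (3 * x' - d)\<bar> = 3 * \<bar>x - x'\<bar>" by (simp add: abs_if)
    ultimately show ?case by (simp add: mult.assoc mult.left_commute)
  qed
  obtain u where u: "(u, y) \<in> okamoto_set q"
    using slice_nonempty[OF q y] unfolding slice_def by blast
  have "x = u" if "(x, y) \<in> okamoto_set q" for x
    using nonpos_if_bounded_powers[of 3 "\<bar>x - u\<bar>"] shrink[OF avoid that u] by auto
  then show ?thesis using that[of u] u okamoto_set_in_square[OF q u] by blast
qed

section \<open>Separation of the first hits\<close>

definition first_hit :: "real \<Rightarrow> nat \<Rightarrow> real set" where
  "first_hit q m = {y \<in> {0..1}. (\<forall>j<m. (unfold_map q ^^ j) y \<notin> overlap q) \<and>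
     (unfold_map q ^^ m) y \<in> overlap q}"

lemma first_hit_0:
  assumes "1 < q"
  shows "first_hit q 0 = overlap q"
proof -
  have "0 < 1 / q" "1 / q < 1" using assms by auto
  then have "0 \<le> y" "y \<le> 1" if "1 - 1 / q \<le> y" "y \<le> 1 / q" for y
    using that by linarith+
  then show ?thesis by (auto simp: first_hit_def overlap_def)
qed

lemma first_hit_SucD:
  assumes "1 < q" "q < 2" "y \<in> first_hit q (Suc m)"
  shows "y \<notin> overlap q" "unfold_map q y \<in> first_hit q m"
proof -
  show "y \<notin> overlap q" using assms(3) unfolding first_hit_def by force
  have "(unfold_map q ^^ j) (unfold_map q y) \<notin> overlap q" if "j < m" for j
    using assms(3) that unfolding first_hit_def by (auto simp: funpow_swap1 dest!: spec[of _ "Suc j"])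
  then show "unfold_map q y \<in> first_hit q m"
    using assms unfold_map_unit unfolding first_hit_def by (auto simp: funpow_swap1)
qed

lemma overlap_avoided_if_no_first_hit:
  assumes "y \<in> {0..1}" "\<And>m. y \<notin> first_hit q m"
  shows "(unfold_map q ^^ n) y \<notin> overlap q"
  using assms by (induction n rule: less_induct) (auto simp: first_hit_def)

text \<open>One step multiplies the distances to \<open>0\<close> and to \<open>1\<close> at most by \<open>q\<close>, and in the overlap both
  are at least \<open>1 - 1/q\<close>.\<close>
lemma first_hit_range:
  assumes q: "1 < q" "q < 2" and "y \<in> first_hit q m"
  shows "(1 - 1 / q) * (1 / q) ^ m \<le> y" "y \<le> 1 - (1 - 1 / q) * (1 / q) ^ m"
proof -
  have "(1 - 1 / q) * (1 / q) ^ m \<le> y \<and> y \<le> 1 - (1 - 1 / q) * (1 / q) ^ m"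
    using assms(3)
  proof (induction m arbitrary: y)
    case 0
    then show ?case using first_hit_0[OF q(1)] by (simp add: overlap_def)
  next
    case (Suc m)
    let ?e = "(1 - 1 / q) * (1 / q) ^ m"
    have "?e \<le> unfold_map q y" "unfold_map q y \<le> 1 - ?e"
      using Suc.IH[OF first_hit_SucD(2)[OF q Suc.prems]] by auto
    moreover have "unfold_map q y \<le> q * y" "1 - unfold_map q y \<le> q * (1 - y)"
      using q by (auto simp: unfold_map_def algebra_simps)
    ultimately have "?e \<le> q * y" "?e \<le> q * (1 - y)" by auto
    then have "?e / q \<le> y" "?e / q \<le> 1 - y" using q by (auto simp: pos_divide_le_eq mult.commute)
    then show ?case by simp
  qed
  then show "(1 - 1 / q) * (1 / q) ^ m \<le> y" "y \<le> 1 - (1 - 1 / q) * (1 / q) ^ m" by auto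
qed

text \<open>As long as two orbits make the same choices, their distance is multiplied by \<open>q\<close> in each step,
  and at the end it is at most the length \<open>2/q - 1\<close> of the overlap. If they choose differently at
  some step, the two points lie on opposite sides of the overlap there, and
  \<open>first_hit_range\<close> pushes their images away from the ends of \<open>[0, 1]\<close>, which keeps the points apart.\<close>
lemma first_hit_separated:
  assumes q: "1 < q" "q < 2" and "x \<in> first_hit q m" "y \<in> first_hit q m"
    and "\<bar>x - y\<bar> < (1 - 1 / q) * (1 / q) ^ m"
  shows "\<bar>x - y\<bar> \<le> (2 / q - 1) * (1 / q) ^ m"
  using assms(3-)
proof (induction m arbitrary: x y)
  case 0
  then show ?case using first_hit_0[OF q(1)] by (auto simp: overlap_def)
next
  case (Suc m)
  let ?e = "(1 - 1 / q) * (1 / q) ^ m"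
  have half: "1 / q > 1 / 2" using q by (simp add: field_simps)
  note Tx = first_hit_SucD[OF q Suc.prems(1)] and Ty = first_hit_SucD[OF q Suc.prems(2)]
  \<comment> \<open>Two lower bounds for the distance across the overlap: its length \<open>2/q - 1\<close>, and twice the
    claimed bound minus this length. Their average is the claim.\<close>
  have opposite: "?e / q \<le> w' - w"
    if w: "w \<le> 1 / 2" "w \<notin> overlap q" "unfold_map q w \<in> first_hit q m"
      and w': "\<not> w' \<le> 1 / 2" "w' \<notin> overlap q" "unfold_map q w' \<in> first_hit q m" for w w'
  proof -
    have "2 / q - 1 \<le> w' - w" using w w' half by (auto simp: overlap_def)
    moreover have "q * w \<le> 1 - ?e" "?e \<le> q * w' - (q - 1)"
      using first_hit_range[OF q w(3)] first_hit_range[OF q w'(3)] w(1) w'(1)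
      by (auto simp: unfold_map_def)
    then have "w \<le> (1 - ?e) / q" "(?e + (q - 1)) / q \<le> w'"
      using q by (auto simp: pos_le_divide_eq pos_divide_le_eq mult.commute)
    then have "2 * (?e / q) - (2 / q - 1) \<le> w' - w"
      using q by (auto simp: diff_divide_distrib add_divide_distrib)
    ultimately show ?thesis by linarith
  qed
  show ?case
  proof (cases "x \<le> 1 / 2 \<longleftrightarrow> y \<le> 1 / 2")
    case True
    then have "unfold_map q x - unfold_map q y = q * (x - y)"
      by (auto simp: unfold_map_def algebra_simps)
    then have eq: "\<bar>unfold_map q x - unfold_map q y\<bar> = q * \<bar>x - y\<bar>" using q by (simp add: abs_mult)
    have "q * \<bar>x - y\<bar> < ?e"
      using Suc.prems(3) q by (simp add: pos_less_divide_eq mult.commute)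
    then have "q * \<bar>x - y\<bar> \<le> (2 / q - 1) * (1 / q) ^ m"
      using Suc.IH[OF Tx(2) Ty(2)] eq by simp
    then show ?thesis using q by (simp add: pos_le_divide_eq mult.commute)
  next
    case False
    then have "?e / q \<le> \<bar>x - y\<bar>"
      using opposite[of x y] opposite[of y x] Tx Ty by fastforce
    then show ?thesis using Suc.prems(3) by simp
  qed
qed

section \<open>Escaping sparse families of sets\<close>

lemma intervals_not_cover:
  fixes a L :: real
  assumes "finite I" and d: "\<And>i. i \<in> I \<Longrightarrow> 0 \<le> d i" and small: "(\<Sum>i\<in>I. d i) < L"
  shows "\<exists>c\<in>{a..a + L}. \<forall>i\<in>I. c \<notin> {p i..p i + d i}"
proof (rule ccontr)
  assume "\<not> ?thesis"
  then have "{a..a + L} \<subseteq> (\<Union>i\<in>I. {p i..p i + d i})" by blast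
  then have "emeasure lborel {a..a + L} \<le> emeasure lborel (\<Union>i\<in>I. {p i..p i + d i})"
    using \<open>finite I\<close> by (intro emeasure_mono) auto
  also have "\<dots> \<le> (\<Sum>i\<in>I. emeasure lborel {p i..p i + d i})"
    using \<open>finite I\<close> by (intro emeasure_subadditive_finite) auto
  also have "\<dots> = (\<Sum>i\<in>I. ennreal (d i))" using d by (intro sum.cong) auto
  also have "\<dots> = ennreal (\<Sum>i\<in>I. d i)" using d by simp
  also have "\<dots> < ennreal L" using small sum_nonneg[of I d] d by (simp add: ennreal_less_iff)
  finally show False using small sum_nonneg[of I d] d by simp
qed

text \<open>The left ends \<open>c\<close> of the windows of width \<open>w\<close> that meet a set of diameter \<open>d\<close> fill an interval
  of length at most \<open>d + w\<close>, and the admissible left ends one of length \<open>L - w\<close>.\<close>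
lemma clear_subinterval:
  fixes a L w :: real
  assumes "finite I" "0 \<le> w" and d: "\<And>i. i \<in> I \<Longrightarrow> 0 \<le> d i"
    and diam: "\<And>i x y. i \<in> I \<Longrightarrow> x \<in> E i \<inter> {a..a + L} \<Longrightarrow> y \<in> E i \<inter> {a..a + L} \<Longrightarrow> \<bar>x - y\<bar> \<le> d i"
    and small: "(\<Sum>i\<in>I. d i + w) < L - w"
  obtains c where "{c..c + w} \<subseteq> {a..a + L}" "\<And>i. i \<in> I \<Longrightarrow> {c..c + w} \<inter> E i = {}"
proof -
  define p where "p i = Inf (E i \<inter> {a..a + L}) - w" for i
  have "\<exists>c\<in>{a..a + (L - w)}. \<forall>i\<in>I. c \<notin> {p i..p i + (d i + w)}"
    using assms by (intro intervals_not_cover) auto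
  then obtain c where c: "a \<le> c" "c \<le> a + (L - w)" "\<And>i. i \<in> I \<Longrightarrow> c \<notin> {p i..p i + (d i + w)}"
    by auto
  have sub: "{c..c + w} \<subseteq> {a..a + L}" using c by auto
  moreover have "{c..c + w} \<inter> E i = {}" if "i \<in> I" for i
  proof (rule ccontr)
    assume "{c..c + w} \<inter> E i \<noteq> {}"
    then obtain e where e: "e \<in> E i" "c \<le> e" "e \<le> c + w" by auto
    then have e': "e \<in> E i \<inter> {a..a + L}" using sub by auto
    have "Inf (E i \<inter> {a..a + L}) \<le> e" using e' by (intro cInf_lower bdd_belowI[of _ a]) auto
    moreover have "e - d i \<le> Inf (E i \<inter> {a..a + L})"
      using e' diam[OF that e'] by (intro cInf_greatest) (auto simp: abs_le_iff algebra_simps)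
    ultimately show False using c(3)[OF that] e unfolding p_def by auto
  qed
  ultimately show ?thesis using that by blast
qed

text \<open>Think of \<open>A i m\<close> as consisting of clusters of diameter at most \<open>\<kappa> r^m\<close> that are more than
  \<open>l r^m\<close> apart. Stage \<open>k\<close> of the construction clears the \<open>b\<close> levels from \<open>b k\<close> on. It starts
  from an interval whose length is the cluster distance of the finest of them,
  \<open>l r^(b k + b - 1)\<close>, so that every level contributes at most one cluster. The numerical
  hypothesis is the condition of \<open>clear_subinterval\<close> divided by \<open>r^(b k)\<close>.\<close>
lemma escape_sparse_families:
  fixes A :: "'i \<Rightarrow> nat \<Rightarrow> real set" and r \<kappa> l :: real
  assumes "finite I" and r: "0 < r" "r < 1" and "0 \<le> \<kappa>" "0 < l" "0 < b"
    and sparse: "\<And>i m x y. i \<in> I \<Longrightarrow> x \<in> A i m \<Longrightarrow> y \<in> A i m \<Longrightarrow> \<bar>x - y\<bar> \<le> l * r ^ m \<Longrightarrow>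
      \<bar>x - y\<bar> \<le> \<kappa> * r ^ m"
    and small: "real (card I) * (\<Sum>j<b. \<kappa> * r ^ j + l * r ^ (2 * b - 1)) < l * r ^ (b - 1) * (1 - r ^ b)"
  shows "\<exists>z\<in>{a..a + l * r ^ (b - 1)}. \<forall>i\<in>I. \<forall>m. z \<notin> A i m"
proof -
  define len where "len k = l * r ^ (b * k + (b - 1))" for k
  have step: "\<exists>c'. {c'..c' + len (Suc k)} \<subseteq> {c..c + len k} \<and>
      (\<forall>i\<in>I. \<forall>j<b. {c'..c' + len (Suc k)} \<inter> A i (b * k + j) = {})" for c k
  proof -
    have len_Suc: "len (Suc k) = r ^ (b * k) * (l * r ^ (2 * b - 1))"
    proof -
      have "b * Suc k + (b - 1) = b * k + (2 * b - 1)" using \<open>0 < b\<close> by simp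
      then show ?thesis unfolding len_def by (simp only: power_add mult_ac)
    qed
    have len: "len k = r ^ (b * k) * (l * r ^ (b - 1))"
      unfolding len_def by (simp only: power_add mult_ac)
    have len_diff: "len k - len (Suc k) = r ^ (b * k) * (l * r ^ (b - 1) * (1 - r ^ b))"
    proof -
      have "2 * b - 1 = (b - 1) + b" using \<open>0 < b\<close> by simp
      then have "r ^ (2 * b - 1) = r ^ (b - 1) * r ^ b" by (simp only: power_add)
      then show ?thesis unfolding len len_Suc by (simp add: algebra_simps)
    qed
    have "(\<Sum>p\<in>I \<times> {..<b}. \<kappa> * r ^ (b * k + snd p) + len (Suc k))
        = (\<Sum>p\<in>I \<times> {..<b}. r ^ (b * k) * (\<kappa> * r ^ snd p + l * r ^ (2 * b - 1)))"
      unfolding len_Suc by (intro sum.cong refl) (simp only: power_add distrib_left mult_ac)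
    also have "\<dots> = (\<Sum>i\<in>I. \<Sum>j<b. r ^ (b * k) * (\<kappa> * r ^ j + l * r ^ (2 * b - 1)))"
      by (subst sum.cartesian_product) (simp only: case_prod_unfold)
    also have "\<dots> = r ^ (b * k) * (real (card I) * (\<Sum>j<b. \<kappa> * r ^ j + l * r ^ (2 * b - 1)))"
      by (simp only: sum_constant sum_distrib_left mult_ac)
    also have "\<dots> < len k - len (Suc k)"
      unfolding len_diff using r by (intro mult_strict_left_mono small) auto
    finally have total: "(\<Sum>p\<in>I \<times> {..<b}. \<kappa> * r ^ (b * k + snd p) + len (Suc k)) < len k - len (Suc k)" .
    have diam: "\<bar>x - y\<bar> \<le> \<kappa> * r ^ (b * k + snd p)"
      if "p \<in> I \<times> {..<b}" "x \<in> A (fst p) (b * k + snd p) \<inter> {c..c + len k}"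
        "y \<in> A (fst p) (b * k + snd p) \<inter> {c..c + len k}" for p x y
    proof -
      have "\<bar>x - y\<bar> \<le> len k" using that by (auto simp: abs_le_iff)
      also have "\<dots> \<le> l * r ^ (b * k + snd p)"
        unfolding len_def using that(1) r \<open>0 < l\<close>
        by (intro mult_left_mono power_decreasing) auto
      finally show ?thesis using that by (intro sparse[of "fst p"]) auto
    qed
    have "0 \<le> len (Suc k)" unfolding len_def using r \<open>0 < l\<close> by simp
    then obtain c' where "{c'..c' + len (Suc k)} \<subseteq> {c..c + len k}"
      "\<And>p. p \<in> I \<times> {..<b} \<Longrightarrow> {c'..c' + len (Suc k)} \<inter> A (fst p) (b * k + snd p) = {}"
      using clear_subinterval[of "I \<times> {..<b}" "len (Suc k)" "\<lambda>p. \<kappa> * r ^ (b * k + snd p)"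
          "\<lambda>p. A (fst p) (b * k + snd p)" c "len k"] \<open>finite I\<close> \<open>0 \<le> \<kappa>\<close> r diam total by auto
    then show ?thesis by fastforce
  qed
  define c where "c = rec_nat a (\<lambda>k c. SOME c'. {c'..c' + len (Suc k)} \<subseteq> {c..c + len k} \<and>
      (\<forall>i\<in>I. \<forall>j<b. {c'..c' + len (Suc k)} \<inter> A i (b * k + j) = {}))"
  have c0: "c 0 = a" by (simp add: c_def)
  have cS: "{c (Suc k)..c (Suc k) + len (Suc k)} \<subseteq> {c k..c k + len k} \<and>
      (\<forall>i\<in>I. \<forall>j<b. {c (Suc k)..c (Suc k) + len (Suc k)} \<inter> A i (b * k + j) = {})" for k
    using someI_ex[OF step[of k "c k"]] by (simp add: c_def)
  have dec: "{c n..c n + len n} \<subseteq> {c m..c m + len m}" if "m \<le> n" for m n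
    using lift_Suc_antimono_le[of "\<lambda>k. {c k..c k + len k}"] cS that by blast
  have "len k \<ge> 0" for k unfolding len_def using r \<open>0 < l\<close> by simp
  then have "(\<Inter>k. {c k..c k + len k}) \<noteq> {}"
    using dec by (intro compact_nest) (auto simp del: atLeastatMost_subset_iff)
  then obtain z where z: "\<And>k. z \<in> {c k..c k + len k}" by blast
  have "z \<notin> A i m" if "i \<in> I" for i m
  proof -
    have "m = b * (m div b) + m mod b" "m mod b < b" using \<open>0 < b\<close> by auto
    then show ?thesis using cS[of "m div b"] z[of "Suc (m div b)"] that by (metis disjoint_iff)
  qed
  moreover have "z \<in> {a..a + l * r ^ (b - 1)}" using z[of 0] unfolding c0 len_def by simp
  ultimately show ?thesis by blast
qed

section \<open>The multinacci bound\<close>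

text \<open>Divided by \<open>q^9\<close>, the defining equation says that the sum of \<open>q^-i\<close> over \<open>i = 1, ..., 9\<close> is \<open>1\<close>.
  This sum is strictly decreasing in \<open>q\<close>, which makes the root unique, and the polynomial changes
  sign between \<open>1.998\<close> and \<open>2\<close>.\<close>
lemma kbonacci_9_gt: "kbonacci 9 > 1.998"
proof -
  let ?P = "\<lambda>q::real. q ^ 9 - (\<Sum>i<9. q ^ i)"
  have "\<exists>x\<ge>1.998. x \<le> 2 \<and> ?P x = 0"
    by (rule IVT') (auto simp: lessThan_nat_numeral eval_nat_numeral intro!: continuous_intros)
  then obtain x where x: "1.998 \<le> x" "x \<le> 2" "?P x = 0" by blast
  have "?P 2 \<noteq> 0" "?P 1.998 \<noteq> 0" by (simp_all add: eval_nat_numeral)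
  then have "x \<noteq> 2" "x \<noteq> 1.998" using x(3) by blast+
  then have x': "1.998 < x" "x < 2" using x by auto
  have "y = x" if y: "1 < y" "y < 2" "?P y = 0" for y
  proof -
    have norm: "(\<Sum>i<9. (1 / w) ^ Suc i) = 1" if "1 < w" "?P w = 0" for w :: real
    proof -
      have "(\<Sum>i<9. (1 / w) ^ Suc i) = (\<Sum>i<9. w ^ (9 - Suc i) / w ^ 9)"
      proof (intro sum.cong refl)
        fix i :: nat assume "i \<in> {..<9}"
        then have "w ^ 9 = w ^ (9 - Suc i) * w ^ Suc i" by (simp flip: power_add del: power_Suc)
        then show "(1 / w) ^ Suc i = w ^ (9 - Suc i) / w ^ 9"
          using that(1) by (simp add: power_divide del: power_Suc)
      qed
      also have "\<dots> = (\<Sum>i<9. w ^ (9 - Suc i)) / w ^ 9" by (rule sum_divide_distrib[symmetric])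
      also have "\<dots> = w ^ 9 / w ^ 9" unfolding sum.nat_diff_reindex using that(2) by simp
      also have "\<dots> = 1" using that(1) by simp
      finally show ?thesis .
    qed
    have strict: "(\<Sum>i<9. (1 / w) ^ Suc i) < (\<Sum>i<9. (1 / v) ^ Suc i)" if "1 < v" "v < w" for v w :: real
      using that by (intro sum_strict_mono power_strict_mono) (auto simp: field_simps lessThan_empty_iff)
    show ?thesis
      using strict[of x y] strict[of y x] norm[of x] norm[of y] x x' y by fastforce
  qed
  then have "kbonacci 9 = x"
    unfolding kbonacci_def using x x' by (intro the_equality) auto
  then show ?thesis using x' by simp
qed

section \<open>Three preimages with one-point slices\<close>

text \<open>The three families are the preimages of the first hit sets under \<open>z\<close>, \<open>1 - \<delta> z\<close> and
  \<open>\<delta> (1 - z)\<close>. The last two arguments stay within \<open>\<delta>\<close> of an end of \<open>[0, 1]\<close>, so by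
  \<open>first_hit_range\<close> they cannot hit the overlap before a time \<open>N\<close> with \<open>q^-N\<close> comparable to \<open>\<delta>\<close>.
  Counting their levels from \<open>N\<close> compensates the stretching of the gaps by \<open>1/\<delta>\<close> and
  brings all three families to the same scale, with clusters at most \<open>0.00201 q^-m\<close> long and
  more than \<open>0.49 q^-m\<close> apart.\<close>
lemma simultaneous_avoidance:
  assumes q: "1.998 < q" "q < 2"
  obtains z where "0 < z" "z < 1" "\<And>n. (unfold_map q ^^ n) z \<notin> overlap q"
    "\<And>n. (unfold_map q ^^ n) (1 - (2 - q) * z) \<notin> overlap q"
    "\<And>n. (unfold_map q ^^ n) ((2 - q) * (1 - z)) \<notin> overlap q"
proof -
  have q1: "1 < q" using q by simp
  define \<delta> r D where "\<delta> = 2 - q" and "r = 1 / q" and "D = 1 - 1 / q"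
  have \<delta>: "0 < \<delta>" "\<delta> < 1 / 500" using q by (auto simp: \<delta>_def)
  have r: "0.5 < r" "r < 0.501" using q by (auto simp: r_def field_simps)
  have D: "0.499 < D" and hole: "2 / q - 1 < 0.002"
    using q by (auto simp: D_def field_simps)
  have hole_D: "2 / q - 1 \<le> 0.00201 * D" using q by (auto simp: D_def field_simps)
  obtain k where "r ^ k < \<delta> / D" using real_arch_pow_inv[of "\<delta> / D" r] \<delta> r D by auto
  then have ex: "\<exists>n. D * r ^ n \<le> \<delta>" using D by (auto simp: field_simps intro: less_imp_le)
  define N where "N = (LEAST n. D * r ^ n \<le> \<delta>)"
  have N: "D * r ^ N \<le> \<delta>" unfolding N_def using ex by (rule LeastI_ex)
  have below_N: "\<delta> < D * r ^ m" if "m < N" for m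
    using not_less_Least[OF that[unfolded N_def]] by simp
  have "N \<noteq> 0" using N D \<delta> by (cases N) auto
  then have "\<delta> < D * r ^ (N - 1)" by (intro below_N) simp
  then have "\<delta> * r < D * r ^ (N - 1) * r" using r by (intro mult_strict_right_mono) auto
  also have "\<dots> = D * r ^ N" using \<open>N \<noteq> 0\<close> by (cases N) auto
  finally have N': "\<delta> * r < D * r ^ N" .
  \<comment> \<open>Family \<open>i\<close>: the affine map \<open>g i\<close>, its slope \<open>s i\<close> in absolute value, and its first relevant
    hitting time \<open>off i\<close>.\<close>
  define s :: "nat \<Rightarrow> real" where "s i = (if i = 0 then 1 else \<delta>)" for i
  define off where "off i = (if i = 0 then 0 else N)" for i :: nat
  define g where "g i z = (if i = 0 then z else if i = 1 then 1 - \<delta> * z else \<delta> * (1 - z))"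
    for i :: nat and z
  have g: "\<bar>g i x - g i y\<bar> = s i * \<bar>x - y\<bar>" for i x y
  proof -
    have "g i x - g i y = x - y \<and> s i = 1 \<or> g i x - g i y = \<delta> * (y - x) \<and> s i = \<delta>"
      by (auto simp: g_def s_def algebra_simps)
    then show ?thesis using \<delta> by (auto simp: abs_mult abs_minus_commute)
  qed
  have s: "0 < s i" for i using \<delta> by (simp add: s_def)
  have upper: "0.49 * s i < D * r ^ off i" for i
  proof -
    have "0.49 * \<delta> < r * \<delta>" using r \<delta> by (intro mult_strict_right_mono) auto
    then show ?thesis using D N' by (auto simp: s_def off_def mult.commute)
  qed
  have lower: "(2 / q - 1) * r ^ off i \<le> 0.00201 * s i" for i
  proof -
    have "(2 / q - 1) * r ^ N \<le> 0.00201 * D * r ^ N"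
      using hole_D r by (intro mult_right_mono) auto
    then show ?thesis using N hole by (auto simp: s_def off_def)
  qed
  define A where "A i m = {z. g i z \<in> first_hit q (m + off i)}" for i m
  \<comment> \<open>The starting point \<open>0.1\<close> only serves to keep \<open>z\<close> away from \<open>0\<close> and \<open>1\<close>.\<close>
  have "\<exists>z\<in>{0.1..0.1 + 0.49 * r ^ (5 - 1)}. \<forall>i\<in>{..<3}. \<forall>m. z \<notin> A i m"
  proof (rule escape_sparse_families[where \<kappa> = "0.00201"])
    show "\<bar>x - y\<bar> \<le> 0.00201 * r ^ m"
      if "x \<in> A i m" "y \<in> A i m" "\<bar>x - y\<bar> \<le> 0.49 * r ^ m" for i m x y
    proof -
      have rm: "0 < r ^ m" using r by simp
      have "s i * \<bar>x - y\<bar> \<le> s i * (0.49 * r ^ m)" using that(3) s[of i] by (intro mult_left_mono) auto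
      also have "\<dots> = 0.49 * s i * r ^ m" by simp
      also have "\<dots> < D * r ^ off i * r ^ m" using upper[of i] rm by (intro mult_strict_right_mono)
      also have "\<dots> = D * r ^ (m + off i)" by (simp add: power_add)
      finally have "\<bar>g i x - g i y\<bar> < (1 - 1 / q) * (1 / q) ^ (m + off i)"
        by (simp add: g D_def r_def)
      then have "\<bar>g i x - g i y\<bar> \<le> (2 / q - 1) * (1 / q) ^ (m + off i)"
        using that unfolding A_def by (intro first_hit_separated[OF q1 q(2)]) auto
      then have "s i * \<bar>x - y\<bar> \<le> (2 / q - 1) * r ^ off i * r ^ m"
        by (simp add: g r_def power_add mult_ac)
      also have "\<dots> \<le> 0.00201 * s i * r ^ m" using lower[of i] rm by (intro mult_right_mono) auto
      finally have "s i * \<bar>x - y\<bar> \<le> s i * (0.00201 * r ^ m)" by (simp add: mult_ac)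
      then show ?thesis using s[of i] by simp
    qed
    have up: "r ^ k \<le> 0.501 ^ k" for k using r by (intro power_mono) auto
    have "0.5 ^ 4 \<le> r ^ 4" using r by (intro power_mono) auto
    moreover have "r * r ^ 4 = r ^ 5" "r ^ 4 * r ^ 5 = r ^ 9" by (simp_all flip: power_add power_Suc)
    ultimately show "real (card {..<3::nat}) * (\<Sum>j<5. 0.00201 * r ^ j + 0.49 * r ^ (2 * 5 - 1))
        < 0.49 * r ^ (5 - 1) * (1 - r ^ 5)"
      using up[of 1] up[of 2] up[of 3] up[of 4] up[of 9]
      by (simp add: lessThan_nat_numeral sum.distrib algebra_simps power_divide) 
  qed (use r in auto)
  then obtain z where z: "0.1 \<le> z" "z \<le> 0.1 + 0.49 * r ^ 4"
    and avoid: "\<And>i m. i < 3 \<Longrightarrow> z \<notin> A i m" by auto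
  have "r ^ 4 \<le> 1" using r by (intro power_le_one) auto
  then have z01: "0 < z" "z < 1" using z by auto
  have prod: "0 < \<delta> * z" "\<delta> * z < \<delta>" using z01 \<delta> by auto
  have unit: "g i z \<in> {0..1}" for i
  proof -
    have "\<delta> * z \<le> 1" "0 \<le> \<delta> - \<delta> * z" "\<delta> - \<delta> * z \<le> 1" using prod \<delta> by linarith+
    then show ?thesis using z01 prod by (simp add: g_def right_diff_distrib)
  qed
  have "g i z \<notin> first_hit q m" if "i < 3" for i m
  proof (cases "off i \<le> m")
    case True
    then show ?thesis using avoid[OF that, of "m - off i"] by (simp add: A_def)
  next
    case False
    then have "i \<noteq> 0" "m < N" by (auto simp: off_def split: if_splits)
    then show ?thesis
      using below_N[of m] first_hit_range[OF q1 q(2), of "g i z" m] prod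
      by (auto simp: g_def D_def r_def right_diff_distrib split: if_splits)
  qed
  then have all: "(unfold_map q ^^ n) (g i z) \<notin> overlap q" if "i < 3" for i n
    using that by (intro overlap_avoided_if_no_first_hit unit) auto
  show ?thesis
    using that[of z] z01 all[of 0] all[of 1] all[of 2] by (simp add: g_def \<delta>_def)
qed

theorem theorem1:
  fixes q :: real
  assumes "kbonacci 9 < q" and "q < 2"
  shows "\<exists>y\<in>{0..1}. card (slice q y) = 3"
proof -
  have q': "1.998 < q" "q < 2" using assms kbonacci_9_gt by auto
  then have q: "1 < q" "q < 2" by auto
  obtain z where z: "0 < z" "z < 1" "\<And>n. (unfold_map q ^^ n) z \<notin> overlap q"
    "\<And>n. (unfold_map q ^^ n) (1 - (2 - q) * z) \<notin> overlap q"
    "\<And>n. (unfold_map q ^^ n) ((2 - q) * (1 - z)) \<notin> overlap q"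
    using simultaneous_avoidance[OF q'] by blast
  have small: "0 \<le> (2 - q) * z" "(2 - q) * z \<le> 1" "0 \<le> (2 - q) * (1 - z)" "(2 - q) * (1 - z) \<le> 1"
    using z q by (auto intro!: mult_le_one)
  obtain u where u: "\<And>x. (x, 1 - (2 - q) * z) \<in> okamoto_set q \<longleftrightarrow> x = u" "0 \<le> u" "u \<le> 1"
    using slice_singleton[OF q _ z(4)] small by auto
  obtain v where v: "\<And>x. (x, z) \<in> okamoto_set q \<longleftrightarrow> x = v" "0 \<le> v" "v \<le> 1"
    using slice_singleton[OF q _ z(3)] z(1,2) by auto
  obtain w where w: "\<And>x. (x, (2 - q) * (1 - z)) \<in> okamoto_set q \<longleftrightarrow> x = w" "0 \<le> w" "w \<le> 1"
    using slice_singleton[OF q _ z(5)] small by auto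
  have "v \<noteq> 0" "v \<noteq> 1"
    using v(1)[of v] okamoto_set_left_edge[OF q] okamoto_set_right_edge[OF q] z(1,2) by auto
  then have v': "0 < v" "v < 1" using v by auto
  \<comment> \<open>The image of \<open>z\<close> under the decreasing branch.\<close>
  define y where "y = (1 - (2 - q) * z) / q"
  have y: "q * y = 1 - (2 - q) * z" "(1 - q * y) / (2 - q) = z" "q * y - (q - 1) = (2 - q) * (1 - z)"
    using q by (auto simp: y_def field_simps)
  have "0 \<le> y" "y \<le> 1" using small q by (auto simp: y_def field_simps)
  moreover have "slice q y = {u / 3, (v + 1) / 3, (w + 2) / 3}"
  proof -
    have "(x, y) \<in> okamoto_set q \<longleftrightarrow> 3 * x = u \<or> 3 * x - 1 = v \<or> 3 * x - 2 = w" for x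
      using mem_okamoto_set_iff[OF q, of x y] unfolding y(2,3) unfolding y(1) u(1) v(1) w(1) .
    moreover have "3 * x = u \<longleftrightarrow> x = u / 3" "3 * x - 1 = v \<longleftrightarrow> x = (v + 1) / 3"
      "3 * x - 2 = w \<longleftrightarrow> x = (w + 2) / 3" for x
      by (auto simp: field_simps)
    ultimately have "(x, y) \<in> okamoto_set q \<longleftrightarrow> x \<in> {u / 3, (v + 1) / 3, (w + 2) / 3}" for x
      by simp
    moreover have "{u / 3, (v + 1) / 3, (w + 2) / 3} \<subseteq> {0..1}" using u v w by auto
    ultimately show ?thesis unfolding slice_def by blast
  qed
  moreover have "card {u / 3, (v + 1) / 3, (w + 2) / 3} = 3"
    using u v' w by auto
  ultimately show ?thesis by (metis atLeastAtMost_iff)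
qed

end
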